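(* Let $n,\ell,k\ge 1$ be integers with $k\ge 2(\ell+1)$, and let $z_1^\star,\ldots,z_n^\star\in\mathbb{R}^\ell$ be arbitrary points, with $d_{ij}=\|z_i^\star-z_j^\star\|$ for all $1\le i<j\le n$. Then the complete-graph squared-stress $$s(z_1,\ldots,z_n)=\frac12\sum_{1\le i<j\le n}\left(\|z_i-z_j\|^2-d_{ij}^2\right)^2,\qquad (z_1,\ldots,z_n)\in(\mathbb{R}^k)^n,$$ has a benign landscape: every second-order critical point of $s$ is a global minimizer of $s$.
   Context: Norms are Euclidean. A second-order critical point of a smooth function on a Euclidean space is a point where the gradient vanishes and the Hessian is positive semidefinite. A function has a benign landscape if all its second-order critical points are global minimizers. *)

theory Defs
  imports "HOL-Analysis.Analysis"
begin

definition gradient :: "('a::euclidean_space \<Rightarrow> real) \<Rightarrow> 'a \<Rightarrow> 'a" where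
  "gradient f x = (THE g. GDERIV f x :> g)"

text \<open>The Hessian is the (total) derivative of the gradient, viewed as a linear operator.\<close>

definition hessian :: "('a::euclidean_space \<Rightarrow> real) \<Rightarrow> 'a \<Rightarrow> 'a \<Rightarrow> 'a" where
  "hessian f x = frechet_derivative (gradient f) (at x)"

text \<open>
  Only meant for smooth functions: where \<open>f\<close> is not twice differentiable, \<open>gradient\<close> and
  \<open>hessian\<close> may have unspecified values.  Symmetry of the Hessian is
  automatic for smooth functions, so positive semidefiniteness only concerns the quadratic form.
\<close>

definition second_order_critical_point :: "('a::euclidean_space \<Rightarrow> real) \<Rightarrow> 'a \<Rightarrow> bool" where
  "second_order_critical_point f x \<longleftrightarrow>
     gradient f x = 0 \<and> (\<forall>v. 0 \<le> v \<bullet> hessian f x v)"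

definition global_minimizer :: "('a \<Rightarrow> real) \<Rightarrow> 'a \<Rightarrow> bool" where
  "global_minimizer f x \<longleftrightarrow> (\<forall>y. f x \<le> f y)"

definition benign_landscape :: "('a::euclidean_space \<Rightarrow> real) \<Rightarrow> bool" where
  "benign_landscape f \<longleftrightarrow>
     (\<forall>x. second_order_critical_point f x \<longrightarrow> global_minimizer f x)"

text \<open>
  A configuration \<open>z\<close> of \<open>n\<close> points in \<open>\<real>\<^sup>k\<close> is a vector of vectors; the norm and inner product
  on this type are the Euclidean ones of \<open>(\<real>\<^sup>k)\<^sup>n\<close>.  The index type \<open>'n\<close> carries a linear order
  so that the sum can run over pairs \<open>i < j\<close>.
\<close>

definition squared_stress ::
    "('n::{finite,linorder} \<Rightarrow> 'n \<Rightarrow> real) \<Rightarrow> real ^ 'k ^ ('n::{finite,linorder}) \<Rightarrow> real" where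
  "squared_stress d z =
     1/2 * (\<Sum>(i, j) | i < j. ((norm (z $ i - z $ j))\<^sup>2 - (d i j)\<^sup>2)\<^sup>2)"

lemma gradient_eqI:
  assumes "GDERIV f x :> g"
  shows "gradient f x = g"
  unfolding gradient_def
proof (rule the_equality)
  fix h assume "GDERIV f x :> h"
  with assms have "(\<lambda>v. v \<bullet> h) = (\<lambda>v. v \<bullet> g)"
    unfolding gderiv_def by (metis has_derivative_unique)
  then show "h = g"
    by (metis vector_eq_ldot)
qed (rule assms)

lemma hessian_eqI:
  assumes "\<And>y. GDERIV f y :> g y" "(g has_derivative H) (at x)"
  shows "hessian f x = H"
proof -
  have "gradient f = g"
    using assms(1) by (intro ext gradient_eqI)
  then show ?thesis
    unfolding hessian_def using frechet_derivative_at[OF assms(2)] by simp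
qed

text \<open>The squared stress is twice differentiable, so the caveat above does not concern it.\<close>

lemma squared_stress_gderiv:
  fixes z :: "real ^ 'k ^ ('n::{finite,linorder})"
  shows "GDERIV (squared_stress d) z :>
    (\<Sum>(i, j) | i < j. (2 * ((norm (z $ i - z $ j))\<^sup>2 - (d i j)\<^sup>2)) *\<^sub>R
       (axis i (z $ i - z $ j) - axis j (z $ i - z $ j)))"
proof -
  let ?P = "{(i, j). i < (j::'n)}"
  have D: "((\<lambda>z::real^'k^('n::{finite,linorder}). ((z $ i - z $ j) \<bullet> (z $ i - z $ j) - c)\<^sup>2) has_derivative
     (\<lambda>h. 4 * ((z $ i - z $ j) \<bullet> (z $ i - z $ j) - c) * ((h $ i - h $ j) \<bullet> (z $ i - z $ j)))) (at z)"
    for i j c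
    by (rule derivative_eq_intros bounded_linear.has_derivative[OF bounded_linear_vec_nth] refl)+
       (simp add: fun_eq_iff inner_commute)
  have "((\<lambda>z. 1/2 * (\<Sum>p\<in>?P. ((z $ fst p - z $ snd p) \<bullet> (z $ fst p - z $ snd p) - (d (fst p) (snd p))\<^sup>2)\<^sup>2))
    has_derivative (\<lambda>h. 1/2 * (\<Sum>p\<in>?P.
      4 * ((z $ fst p - z $ snd p) \<bullet> (z $ fst p - z $ snd p) - (d (fst p) (snd p))\<^sup>2) *
        ((h $ fst p - h $ snd p) \<bullet> (z $ fst p - z $ snd p))))) (at z)"
    by (intro has_derivative_mult_right has_derivative_sum D)
  moreover have "1/2 * (\<Sum>p\<in>?P.
      4 * ((z $ fst p - z $ snd p) \<bullet> (z $ fst p - z $ snd p) - (d (fst p) (snd p))\<^sup>2) *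
        ((h $ fst p - h $ snd p) \<bullet> (z $ fst p - z $ snd p))) =
    h \<bullet> (\<Sum>(i, j)\<in>?P. (2 * ((norm (z $ i - z $ j))\<^sup>2 - (d i j)\<^sup>2)) *\<^sub>R
       (axis i (z $ i - z $ j) - axis j (z $ i - z $ j)))" for h
    unfolding sum_distrib_left inner_sum_right case_prod_unfold
    by (intro sum.cong refl)
       (simp only: inner_scaleR_right inner_diff_right inner_axis inner_diff_left[of "h $ _" "h $ _"]
          power2_norm_eq_inner, simp add: algebra_simps)
  ultimately show ?thesis
    by (simp only: gderiv_def squared_stress_def[abs_def] power2_norm_eq_inner case_prod_unfold)
qed

lemma gradient_squared_stress_differentiable:
  "gradient (squared_stress d) differentiable (at (z :: real ^ 'k ^ ('n::{finite,linorder})))"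
proof -
  have *: "gradient (squared_stress d) = (\<lambda>z::real^'k^('n::{finite,linorder}).
    \<Sum>(i, j) | i < j. (2 * ((norm (z $ i - z $ j))\<^sup>2 - (d i j)\<^sup>2)) *\<^sub>R
       (axis i (z $ i - z $ j) - axis j (z $ i - z $ j)))"
    by (intro ext gradient_eqI squared_stress_gderiv)
  have diff: "(\<lambda>z::real^'k^('n::{finite,linorder}). z $ i - z $ j) differentiable (at z)" for i j
    by (intro differentiable_diff bounded_linear_imp_differentiable bounded_linear_vec_nth)
  have ax: "bounded_linear (axis i :: real ^ 'k \<Rightarrow> real ^ 'k ^ ('n::{finite,linorder}))" for i
    by (intro linear_conv_bounded_linear[THEN iffD1] linearI) (auto simp: axis_def vec_eq_iff)
  have axd: "(\<lambda>z::real^'k^('n::{finite,linorder}). axis m (z $ i - z $ j) :: real ^ 'k ^ ('n::{finite,linorder})) differentiable (at z)" for m i j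
    using differentiable_compose[OF bounded_linear_imp_differentiable[OF ax] diff] by simp
  show ?thesis
    unfolding * case_prod_unfold power2_norm_eq_inner
    by (intro differentiable_sum differentiable_scaleR differentiable_diff differentiable_mult
        differentiable_inner differentiable_const ballI axd diff finite)
qed

end

theory Submission
  imports Defs
begin

text \<open>
  Write \<open>w i j\<close> for the residuals of the squared distances and \<open>c i\<close> for their row sums, and centre the
  configuration \<open>p\<close>.  Let \<open>G = (\<Sum>i. p i p i\<^sup>T)\<close>.  If \<open>x\<close> satisfies \<open>(\<Sum>i. (p i \<bullet> x) q i) = 0\<close>, where \<open>q\<close> is
  the target, the gradient condition tested in the direction \<open>i \<mapsto> (p i \<bullet> x) x\<close> reads
  \<open>(\<Sum>i. c i (p i \<bullet> x)\<^sup>2) = - 2 \<parallel>G x\<parallel>\<^sup>2\<close>.  For the index \<open>i0\<close> minimising \<open>c\<close> and \<open>\<lambda> = - c i0 / 2\<close> this gives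
  \<open>\<parallel>G x\<parallel>\<^sup>2 \<le> \<lambda> (x \<bullet> G x)\<close>, hence \<open>x \<bullet> G x \<le> \<lambda> \<parallel>x\<parallel>\<^sup>2\<close> by Cauchy-Schwarz.  If moreover \<open>p i0 \<bullet> x = 0\<close>, the Hessian
  condition for moving only the point \<open>i0\<close> along \<open>x\<close> is the reverse inequality, so this direction lies
  in the kernel of the Hessian.  Choosing \<open>x\<close> also orthogonal to \<open>p j\<close>, which costs \<open>\<ell> + 2 < k\<close> linear
  conditions in total, the kernel equation says \<open>w i0 j = 0\<close>.  As \<open>j\<close> is arbitrary, \<open>c i0 = 0\<close>,
  contradicting \<open>\<lambda> > 0\<close>.  The argument needs \<open>x \<bullet> G x > 0\<close>; when \<open>G\<close> is singular, optimality follows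
  from convexity in the Gram matrix.
\<close>

section \<open>Linear algebra, symmetric double sums and Laplacian forms\<close>

lemma linear_nontrivial_kernel:
  fixes f :: "'a::euclidean_space \<Rightarrow> 'b::euclidean_space"
  assumes "linear f" "DIM('b) < DIM('a)"
  obtains x where "x \<noteq> 0" "f x = 0"
proof -
  have "\<not> inj f"
  proof
    assume "inj f"
    then have "dim (range f) = DIM('a)"
      using dim_image_eq[OF assms(1), of UNIV] by simp
    with assms(2) dim_subset_UNIV[of "range f"] show False
      by simp
  qed
  then show ?thesis
    using assms(1) that linear_injective_0 by blast
qed

lemma sum_symmetric_pairs:
  fixes f :: "'n::{finite,linorder} \<Rightarrow> 'n \<Rightarrow> real"
  assumes sym: "\<And>i j. f i j = f j i" and diag: "\<And>i. f i i = 0"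
  shows "(\<Sum>i\<in>UNIV. \<Sum>j\<in>UNIV. f i j) = 2 * (\<Sum>(i, j) | i < j. f i j)"
proof -
  have U: "(UNIV :: ('n \<times> 'n) set) = {(i, j). i < j} \<union> ({(i, j). j < i} \<union> {(i, j). i = j})"
    by auto
  have "(\<Sum>i\<in>UNIV. \<Sum>j\<in>UNIV. f i j) = (\<Sum>(i, j)\<in>UNIV. f i j)"
    by (simp add: sum.cartesian_product)
  also have "\<dots> = (\<Sum>(i, j) | i < j. f i j) + ((\<Sum>(i, j) | j < i. f i j) + (\<Sum>(i, j) | i = j. f i j))"
    unfolding U by (subst sum.union_disjoint; (subst sum.union_disjoint)?) auto
  also have "(\<Sum>(i, j) | i = j. f i j) = 0"
    by (intro sum.neutral) (auto simp: diag)
  also have "(\<Sum>(i, j) | j < i. f i j) = (\<Sum>(i, j) | i < j. f i j)"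
    by (rule sum.reindex_bij_witness[of _ "\<lambda>(i, j). (j, i)" "\<lambda>(i, j). (j, i)"]) (auto simp: sym)
  finally show ?thesis by simp
qed

lemma laplacian_form_expand:
  fixes W :: "'n::finite \<Rightarrow> 'n \<Rightarrow> real"
  assumes sym: "\<And>i j. W i j = W j i"
  shows "(\<Sum>i\<in>UNIV. \<Sum>j\<in>UNIV. W i j * (u i - u j)\<^sup>2) =
    2 * (\<Sum>i\<in>UNIV. (\<Sum>j\<in>UNIV. W i j) * (u i)\<^sup>2) - 2 * (\<Sum>i\<in>UNIV. \<Sum>j\<in>UNIV. W i j * (u i * u j))"
proof -
  have "(\<Sum>i\<in>UNIV. \<Sum>j\<in>UNIV. W i j * (u i - u j)\<^sup>2) =
      (\<Sum>i\<in>UNIV. \<Sum>j\<in>UNIV. W i j * (u i)\<^sup>2) + (\<Sum>i\<in>UNIV. \<Sum>j\<in>UNIV. W i j * (u j)\<^sup>2)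
      - 2 * (\<Sum>i\<in>UNIV. \<Sum>j\<in>UNIV. W i j * (u i * u j))"
    by (simp add: power2_diff algebra_simps sum.distrib sum_subtractf sum_distrib_left)
  also have "(\<Sum>i\<in>UNIV. \<Sum>j\<in>UNIV. W i j * (u j)\<^sup>2) = (\<Sum>i\<in>UNIV. \<Sum>j\<in>UNIV. W i j * (u i)\<^sup>2)"
    by (subst sum.swap) (simp add: sym)
  finally show ?thesis
    by (simp add: sum_distrib_right)
qed

text \<open>Testing the form on the indicator of \<open>i\<close> plus \<open>s\<close> times that
  of \<open>j\<close> gives a quadratic in \<open>s\<close> with constant term the row sum of
  \<open>i\<close> and linear term \<open>- 2 * s * W i j\<close>. At \<open>s = 0\<close> it is the
  row sum; if that vanishes, a small \<open>s\<close> of the sign of \<open>W i j\<close> would make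
  the quadratic negative unless \<open>W i j = 0\<close>.\<close>

lemma
  fixes W :: "'n::finite \<Rightarrow> 'n \<Rightarrow> real"
  assumes sym: "\<And>i j. W i j = W j i" and diag: "\<And>i. W i i = 0"
    and psd: "\<And>u. 0 \<le> (\<Sum>i\<in>UNIV. \<Sum>j\<in>UNIV. W i j * (u i - u j)\<^sup>2)"
  shows laplacian_psd_row_sum_nonneg: "0 \<le> (\<Sum>j\<in>UNIV. W i j)"
    and laplacian_psd_row_sum_zero: "(\<Sum>j\<in>UNIV. W i j) = 0 \<Longrightarrow> W i j = 0"
proof -
  have Q: "0 \<le> (\<Sum>m\<in>UNIV. W i m) + s\<^sup>2 * (\<Sum>m\<in>UNIV. W j m) - 2 * s * W i j" if "i \<noteq> j" for s i j
  proof -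
    let ?u = "\<lambda>m. of_bool (m = i) + s * of_bool (m = j) :: real"
    have sq: "(?u m)\<^sup>2 = of_bool (m = i) + s\<^sup>2 * of_bool (m = j)" for m
      using that by (simp add: power2_eq_square)
    have "(\<Sum>m\<in>UNIV. \<Sum>n\<in>UNIV. W m n * (?u m * ?u n)) =
        (\<Sum>m\<in>UNIV. ?u m * (\<Sum>n\<in>UNIV. W m n * ?u n))"
      by (simp add: sum_distrib_left mult_ac)
    also have "\<dots> = 2 * s * W i j"
      using that by (simp add: distrib_left distrib_right sum.distrib mult.assoc mult.left_commute
          flip: sum_distrib_left)
        (simp add: diag sym[of j i])
    finally have "(\<Sum>m\<in>UNIV. \<Sum>n\<in>UNIV. W m n * (?u m * ?u n)) = 2 * s * W i j" .
    moreover have "(\<Sum>m\<in>UNIV. (\<Sum>n\<in>UNIV. W m n) * (?u m)\<^sup>2) =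
        (\<Sum>m\<in>UNIV. W i m) + s\<^sup>2 * (\<Sum>m\<in>UNIV. W j m)"
    proof -
      have "(\<Sum>m\<in>UNIV. (\<Sum>n\<in>UNIV. W m n) * (?u m)\<^sup>2) =
          (\<Sum>m\<in>UNIV. (\<Sum>n\<in>UNIV. W m n) * of_bool (m = i)) +
          s\<^sup>2 * (\<Sum>m\<in>UNIV. (\<Sum>n\<in>UNIV. W m n) * of_bool (m = j))"
        unfolding sq by (simp only: distrib_left sum.distrib mult.left_commute sum_distrib_left)
      then show ?thesis by simp
    qed
    ultimately show ?thesis
      using psd[of ?u] unfolding laplacian_form_expand[of W, OF sym] by simp
  qed
  show "0 \<le> (\<Sum>j\<in>UNIV. W i j)"
  proof (cases "\<exists>j. i \<noteq> j")
    case True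
    then show ?thesis using Q[of i _ 0] by auto
  next
    case False
    then show ?thesis by (metis diag order_refl sum.neutral)
  qed
  assume 0: "(\<Sum>j\<in>UNIV. W i j) = 0"
  show "W i j = 0"
  proof (cases "i = j")
    case False
    let ?r = "\<Sum>m\<in>UNIV. W j m"
    \<comment> \<open>The step \<open>s = e * W i j\<close> has the sign of \<open>W i j\<close>,
      and \<open>e\<close> is small enough that the linear term outweighs the \<open>s\<close>
      squared term.\<close>
    define e where "e = 1 / (\<bar>?r\<bar> + 1)"
    have e: "e > 0" "e * ?r < 1"
      by (auto simp: e_def field_simps)
    have "0 \<le> (e * W i j)\<^sup>2 * ?r - 2 * (e * W i j) * W i j"
      using Q[OF False, of "e * W i j"] 0 by simp
    also have "\<dots> = (e * (W i j)\<^sup>2) * (e * ?r - 2)"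
      by (simp add: power2_eq_square algebra_simps)
    finally have "e * (W i j)\<^sup>2 \<le> 0"
      using e by (simp add: zero_le_mult_iff)
    then show ?thesis
      using e by (simp add: mult_le_0_iff)
  qed (simp add: diag)
qed

text \<open>After expanding the squared distances, the terms in a single \<open>norm (p i)\<close>
  or \<open>norm (p j)\<close> are killed by the zero sum of \<open>u\<close>; only the Gram part
  survives.\<close>

lemma sum_sq_dist_zero_sum:
  fixes p :: "'n::finite \<Rightarrow> 'a::real_inner"
  assumes "(\<Sum>i\<in>UNIV. u i) = 0"
  shows "(\<Sum>i\<in>UNIV. \<Sum>j\<in>UNIV. (norm (p i - p j))\<^sup>2 * (u i * u j)) =
    - 2 * (norm (\<Sum>i\<in>UNIV. u i *\<^sub>R p i))\<^sup>2"
proof -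
  have "(\<Sum>i\<in>UNIV. \<Sum>j\<in>UNIV. (norm (p i - p j))\<^sup>2 * (u i * u j)) =
     (\<Sum>i\<in>UNIV. \<Sum>j\<in>UNIV. ((norm (p i))\<^sup>2 * u i) * u j) + (\<Sum>i\<in>UNIV. \<Sum>j\<in>UNIV. u i * ((norm (p j))\<^sup>2 * u j))
     - 2 * (\<Sum>i\<in>UNIV. \<Sum>j\<in>UNIV. (u i *\<^sub>R p i) \<bullet> (u j *\<^sub>R p j))"
    unfolding sum_distrib_left
    by (simp add: power2_norm_eq_inner inner_commute algebra_simps flip: sum.distrib sum_subtractf)
  also have "(\<Sum>i\<in>UNIV. \<Sum>j\<in>UNIV. (u i *\<^sub>R p i) \<bullet> (u j *\<^sub>R p j)) = (norm (\<Sum>i\<in>UNIV. u i *\<^sub>R p i))\<^sup>2"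
    unfolding power2_norm_eq_inner by (simp only: inner_sum_left) (simp only: inner_sum_right)
  also have "(\<Sum>i\<in>UNIV. \<Sum>j\<in>UNIV. ((norm (p i))\<^sup>2 * u i) * u j) = 0"
    by (simp add: assms flip: sum_distrib_left)
  also have "(\<Sum>i\<in>UNIV. \<Sum>j\<in>UNIV. u i * ((norm (p j))\<^sup>2 * u j)) = 0"
    by (simp add: assms flip: sum_distrib_left sum_distrib_right)
  finally show ?thesis by simp
qed

lemma sum_inner_Basis_squares:
  "(\<Sum>b\<in>Basis. (x \<bullet> b)\<^sup>2) = (norm (x::'a::euclidean_space))\<^sup>2"
  unfolding power2_norm_eq_inner euclidean_inner[of x x] by (simp only: power2_eq_square)

section \<open>Vanishing of the residuals at a second-order critical point\<close>

text \<open>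
  If all differences \<open>p i - p j\<close> are orthogonal to a common \<open>x\<close>, moving along \<open>x\<close> has no effect on
  the Gram terms of the Hessian, which makes the convex dual certificate positive semidefinite.
\<close>

lemma stress_residual_zero_degenerate:
  fixes p :: "'n::finite \<Rightarrow> 'a::euclidean_space" and q :: "'n \<Rightarrow> 'b::euclidean_space"
  assumes w_def: "\<And>i j. w i j = (norm (p i - p j))\<^sup>2 - (norm (q i - q j))\<^sup>2"
    and crit: "\<And>x. (\<Sum>i\<in>UNIV. \<Sum>j\<in>UNIV. w i j * ((p i - p j) \<bullet> x)\<^sup>2) = 0"
    and hess: "\<And>u x. 0 \<le> (\<Sum>i\<in>UNIV. \<Sum>j\<in>UNIV.
      (w i j * (norm x)\<^sup>2 + 2 * ((p i - p j) \<bullet> x)\<^sup>2) * (u i - u j)\<^sup>2)"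
    and x: "x \<noteq> 0" "\<And>i j. (p i - p j) \<bullet> x = 0"
  shows "w i j = 0"
proof -
  have psd: "0 \<le> (\<Sum>i\<in>UNIV. \<Sum>j\<in>UNIV. w i j * (u i - u j)\<^sup>2)" for u
  proof -
    have "0 \<le> (norm x)\<^sup>2 * (\<Sum>i\<in>UNIV. \<Sum>j\<in>UNIV. w i j * (u i - u j)\<^sup>2)"
      using hess[of x u] x(2) by (simp add: sum_distrib_left mult_ac)
    then show ?thesis
      using x(1) by (simp add: zero_le_mult_iff)
  qed
  \<comment> \<open>Each coordinate of the target is a test vector for \<open>psd\<close>; summing
    over coordinates recovers the squared distances.\<close>
  have "0 \<le> (\<Sum>b\<in>Basis. \<Sum>i\<in>UNIV. \<Sum>j\<in>UNIV. w i j * (q i \<bullet> b - q j \<bullet> b)\<^sup>2)"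
    by (rule sum_nonneg) (rule psd)
  also have "\<dots> = (\<Sum>i\<in>UNIV. \<Sum>j\<in>UNIV. w i j * (norm (q i - q j))\<^sup>2)"
    by (simp add: sum.swap[of _ _ Basis] flip: sum_inner_Basis_squares inner_diff_left sum_distrib_left)
  finally have q: "0 \<le> (\<Sum>i\<in>UNIV. \<Sum>j\<in>UNIV. w i j * (norm (q i - q j))\<^sup>2)" .
  have "(\<Sum>b\<in>Basis. \<Sum>i\<in>UNIV. \<Sum>j\<in>UNIV. w i j * ((p i - p j) \<bullet> b)\<^sup>2) =
      (\<Sum>i\<in>UNIV. \<Sum>j\<in>UNIV. w i j * (norm (p i - p j))\<^sup>2)"
    by (simp add: sum.swap[of _ _ Basis] flip: sum_inner_Basis_squares sum_distrib_left)
  then have p: "(\<Sum>i\<in>UNIV. \<Sum>j\<in>UNIV. w i j * (norm (p i - p j))\<^sup>2) = 0"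
    by (simp add: crit)
  \<comment> \<open>Expanding one factor \<open>w i j\<close> of the square pairs the residuals with
    the distances of \<open>p\<close>, which gives zero, and of \<open>q\<close>, which gives a
    nonnegative number entering with a minus sign.\<close>
  have "(\<Sum>i\<in>UNIV. \<Sum>j\<in>UNIV. (w i j)\<^sup>2) =
      (\<Sum>i\<in>UNIV. \<Sum>j\<in>UNIV. w i j * (norm (p i - p j))\<^sup>2) - (\<Sum>i\<in>UNIV. \<Sum>j\<in>UNIV. w i j * (norm (q i - q j))\<^sup>2)"
    by (simp add: w_def power2_eq_square algebra_simps flip: sum_subtractf)
  also have "\<dots> \<le> 0"
    using p q by simp
  finally have "(\<Sum>i\<in>UNIV. \<Sum>j\<in>UNIV. (w i j)\<^sup>2) = 0"
    by (intro antisym sum_nonneg) auto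
  then show ?thesis
    by (simp add: sum_nonneg_eq_0_iff sum_nonneg)
qed

lemma stress_residual_zero_centred:
  fixes p :: "'n::finite \<Rightarrow> 'a::euclidean_space" and q :: "'n \<Rightarrow> 'b::euclidean_space"
  assumes w_def: "\<And>i j. w i j = (norm (p i - p j))\<^sup>2 - (norm (q i - q j))\<^sup>2"
    and dim: "DIM('b) + 3 \<le> DIM('a)"
    and centred: "(\<Sum>i\<in>UNIV. p i) = 0"
    and crit: "\<And>x. (\<Sum>i\<in>UNIV. \<Sum>j\<in>UNIV. w i j * ((p i - p j) \<bullet> x)\<^sup>2) = 0"
    and hess: "\<And>u x. 0 \<le> (\<Sum>i\<in>UNIV. \<Sum>j\<in>UNIV.
      (w i j * (norm x)\<^sup>2 + 2 * ((p i - p j) \<bullet> x)\<^sup>2) * (u i - u j)\<^sup>2)"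
  shows "w i j = 0"
proof (cases "\<exists>x. x \<noteq> 0 \<and> (\<forall>i j. (p i - p j) \<bullet> x = 0)")
  case True
  then obtain x where "x \<noteq> 0" "\<And>i j. (p i - p j) \<bullet> x = 0"
    by blast
  then show ?thesis
    by (rule stress_residual_zero_degenerate[of w p q, OF w_def crit hess])
next
  case False
  have wsym: "w i j = w j i" for i j
    by (simp add: w_def norm_minus_commute)
  define c where "c i = (\<Sum>j\<in>UNIV. w i j)" for i
  define g where "g x = (\<Sum>i\<in>UNIV. (p i \<bullet> x)\<^sup>2)" for x
  define G where "G x = (\<Sum>i\<in>UNIV. (p i \<bullet> x) *\<^sub>R p i)" for x
  have g_pos: "0 < g x" if "x \<noteq> 0" for x
  proof -
    have "g x \<noteq> 0"
    proof
      assume "g x = 0"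
      then have "\<forall>i. p i \<bullet> x = 0"
        by (simp add: g_def sum_nonneg_eq_0_iff)
      with False that show False
        by (auto simp: inner_diff_left)
    qed
    then show ?thesis
      by (simp add: g_def sum_nonneg less_le)
  qed
  have gG: "g x = x \<bullet> G x" for x
    by (simp add: g_def G_def inner_sum_right power2_eq_square inner_commute)
  define i0 where "i0 = arg_min_on c UNIV"
  have i0: "c i0 \<le> c i" for i
    unfolding i0_def by (rule arg_min_least) auto
  have main: "w i0 j = 0 \<and> c i0 < 0" for j
  proof -
    \<comment> \<open>The codomain has dimension \<open>DIM('b) + 2\<close>, which explains the 3 in
      \<open>dim\<close>. As \<open>x\<close> depends on \<open>j\<close>, the inequalities below
      are rederived for each \<open>j\<close>.\<close>
    let ?f = "\<lambda>x. ((\<Sum>i\<in>UNIV. (p i \<bullet> x) *\<^sub>R q i), p i0 \<bullet> x, p j \<bullet> x)"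
    have "linear ?f"
      by (intro linearI)
        (auto simp: inner_add_right scaleR_add_left sum.distrib scaleR_sum_right)
    moreover have "DIM('b \<times> real \<times> real) < DIM('a)"
      using dim by simp
    ultimately obtain x where x0: "x \<noteq> 0" and "?f x = 0"
      by (rule linear_nontrivial_kernel)
    then have x: "(\<Sum>i\<in>UNIV. (p i \<bullet> x) *\<^sub>R q i) = 0" "p i0 \<bullet> x = 0" "p j \<bullet> x = 0"
      by (auto simp: zero_prod_def)
    have zero_sum: "(\<Sum>i\<in>UNIV. p i \<bullet> x) = 0"
      by (simp add: centred flip: inner_sum_left)
    \<comment> \<open>The target contributes nothing, by the choice of \<open>x\<close>; centring
      supplies the zero sum of the weights.\<close>
    have "(\<Sum>i\<in>UNIV. \<Sum>j\<in>UNIV. w i j * ((p i \<bullet> x) * (p j \<bullet> x))) = - 2 * (norm (G x))\<^sup>2"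
      using sum_sq_dist_zero_sum[OF zero_sum, of p] sum_sq_dist_zero_sum[OF zero_sum, of q] x(1)
      by (simp add: w_def G_def left_diff_distrib sum_subtractf)
    moreover have "(\<Sum>i\<in>UNIV. \<Sum>j\<in>UNIV. w i j * (p i \<bullet> x - p j \<bullet> x)\<^sup>2) = 0"
      using crit[of x] by (simp add: inner_diff_left)
    ultimately have "(\<Sum>i\<in>UNIV. c i * (p i \<bullet> x)\<^sup>2) = - 2 * (norm (G x))\<^sup>2"
      unfolding laplacian_form_expand[of w, OF wsym] by (simp add: c_def)
    moreover have "c i0 * g x \<le> (\<Sum>i\<in>UNIV. c i * (p i \<bullet> x)\<^sup>2)"
      unfolding g_def sum_distrib_left by (intro sum_mono mult_right_mono i0) auto
    ultimately have G_le: "2 * (norm (G x))\<^sup>2 \<le> - c i0 * g x"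
      by simp
    have cs: "(g x)\<^sup>2 \<le> (norm x)\<^sup>2 * (norm (G x))\<^sup>2"
      using Cauchy_Schwarz_ineq[of x "G x"] by (simp add: gG power2_norm_eq_inner)
    have "2 * (g x)\<^sup>2 \<le> (norm x)\<^sup>2 * (- c i0 * g x)"
      using cs mult_left_mono[OF G_le, of "(norm x)\<^sup>2"] by simp
    then have "g x * (2 * g x) \<le> g x * (- c i0 * (norm x)\<^sup>2)"
      by (simp add: power2_eq_square mult_ac)
    then have upper: "2 * g x \<le> - c i0 * (norm x)\<^sup>2"
      using g_pos[OF x0] by (rule mult_left_le_imp_le)
    then have "c i0 * (norm x)\<^sup>2 < 0"
      using g_pos[OF x0] by simp
    then have c_neg: "c i0 < 0"
      by (simp add: mult_less_0_iff)
    define W where "W i j = w i j * (norm x)\<^sup>2 + 2 * ((p i - p j) \<bullet> x)\<^sup>2" for i j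
    have W: "W i j = W j i" "W i i = 0" for i j
      by (auto simp: W_def wsym[of i j] inner_diff_left power2_commute) (simp add: w_def)
    have psd: "0 \<le> (\<Sum>i\<in>UNIV. \<Sum>j\<in>UNIV. W i j * (u i - u j)\<^sup>2)" for u
      using hess[of x u] by (simp add: W_def)
    have row: "(\<Sum>j\<in>UNIV. W i0 j) = c i0 * (norm x)\<^sup>2 + 2 * g x"
      by (simp add: W_def sum.distrib c_def g_def inner_diff_left x(2) sum_distrib_left sum_distrib_right)
    \<comment> \<open>The Hessian bounds this row sum below by 0 and \<open>upper\<close> bounds it
      above by 0.\<close>
    have "(\<Sum>j\<in>UNIV. W i0 j) = 0"
      using laplacian_psd_row_sum_nonneg[of W i0, OF W psd] upper row by simp
    then have "W i0 j = 0"
      by (rule laplacian_psd_row_sum_zero[of W, OF W psd])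
    then have "w i0 j = 0"
      using x0 by (simp add: W_def inner_diff_left x)
    with c_neg show ?thesis by simp
  qed
  then have "c i0 = 0"
    unfolding c_def[of i0] by (intro sum.neutral) simp
  with main show ?thesis by simp
qed

text \<open>Residuals and both conditions involve only differences of points, so translating the
  mean to the origin changes nothing.\<close>

lemma stress_residual_zero:
  fixes p :: "'n::finite \<Rightarrow> 'a::euclidean_space" and q :: "'n \<Rightarrow> 'b::euclidean_space"
  assumes w_def: "\<And>i j. w i j = (norm (p i - p j))\<^sup>2 - (norm (q i - q j))\<^sup>2"
    and dim: "DIM('b) + 3 \<le> DIM('a)"
    and crit: "\<And>x. (\<Sum>i\<in>UNIV. \<Sum>j\<in>UNIV. w i j * ((p i - p j) \<bullet> x)\<^sup>2) = 0"
    and hess: "\<And>u x. 0 \<le> (\<Sum>i\<in>UNIV. \<Sum>j\<in>UNIV.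
      (w i j * (norm x)\<^sup>2 + 2 * ((p i - p j) \<bullet> x)\<^sup>2) * (u i - u j)\<^sup>2)"
  shows "w i j = 0"
proof -
  define m where "m = (1 / real CARD('n)) *\<^sub>R (\<Sum>i\<in>UNIV. p i)"
  have centred: "(\<Sum>i\<in>UNIV. p i - m) = 0"
    by (simp add: sum_subtractf m_def sum_constant_scaleR)
  have diff: "p i - m - (p j - m) = p i - p j" for i j
    by simp
  show ?thesis
    by (rule stress_residual_zero_centred[of w "\<lambda>i. p i - m" q, unfolded diff,
          OF w_def dim centred crit hess])
qed

section \<open>Derivatives of the squared stress and the landscape theorem\<close>

lemma inner_hessian_squared_stress:
  fixes z :: "real ^ 'k ^ ('n::{finite,linorder})"
  shows "v \<bullet> hessian (squared_stress d) z v =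
    (\<Sum>(i, j) | i < j. 2 * ((norm (z $ i - z $ j))\<^sup>2 - (d i j)\<^sup>2) * (norm (v $ i - v $ j))\<^sup>2
       + 4 * ((z $ i - z $ j) \<bullet> (v $ i - v $ j))\<^sup>2)"
proof -
  have A: "bounded_linear (\<lambda>h::real^'k^('n::{finite,linorder}). axis i (h $ i - h $ j) - axis j (h $ i - h $ j) :: real^'k^('n::{finite,linorder}))" for i j
    by (intro linear_conv_bounded_linear[THEN iffD1] linearI)
      (auto simp: axis_def vec_eq_iff algebra_simps)
  have f: "((\<lambda>z::real^'k^('n::{finite,linorder}). 2 * ((z $ i - z $ j) \<bullet> (z $ i - z $ j) - (d i j)\<^sup>2)) has_derivative
      (\<lambda>h. 4 * ((z $ i - z $ j) \<bullet> (h $ i - h $ j)))) (at z)" for i j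
    by (rule derivative_eq_intros bounded_linear.has_derivative[OF bounded_linear_vec_nth] refl)+
       (simp add: fun_eq_iff inner_commute)
  have D: "((\<lambda>z::real^'k^('n::{finite,linorder}). (2 * ((z $ i - z $ j) \<bullet> (z $ i - z $ j) - (d i j)\<^sup>2)) *\<^sub>R
        (axis i (z $ i - z $ j) - axis j (z $ i - z $ j))) has_derivative
     (\<lambda>h. (2 * ((z $ i - z $ j) \<bullet> (z $ i - z $ j) - (d i j)\<^sup>2)) *\<^sub>R
        (axis i (h $ i - h $ j) - axis j (h $ i - h $ j)) +
        (4 * ((z $ i - z $ j) \<bullet> (h $ i - h $ j))) *\<^sub>R
        (axis i (z $ i - z $ j) - axis j (z $ i - z $ j)))) (at z)"
    for i j
    by (rule has_derivative_scaleR[OF f bounded_linear_imp_has_derivative[OF A]])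
  have "hessian (squared_stress d) z = (\<lambda>h. \<Sum>p | fst p < snd p. case p of (i, j) \<Rightarrow>
     (2 * ((z $ i - z $ j) \<bullet> (z $ i - z $ j) - (d i j)\<^sup>2)) *\<^sub>R
        (axis i (h $ i - h $ j) - axis j (h $ i - h $ j)) +
        (4 * ((z $ i - z $ j) \<bullet> (h $ i - h $ j))) *\<^sub>R
        (axis i (z $ i - z $ j) - axis j (z $ i - z $ j)))"
    by (rule hessian_eqI, rule squared_stress_gderiv)
      (unfold case_prod_unfold power2_norm_eq_inner, intro has_derivative_sum D)
  then show ?thesis
    by (simp add: inner_sum_right case_prod_unfold inner_add_right inner_diff_right inner_axis
        power2_norm_eq_inner)
      (intro sum.cong refl, simp add: power2_eq_square inner_commute algebra_simps)
qed

lemma inner_gradient_squared_stress: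
  fixes z :: "real ^ 'k ^ ('n::{finite,linorder})"
  shows "v \<bullet> gradient (squared_stress d) z =
    (\<Sum>(i, j) | i < j. 2 * ((norm (z $ i - z $ j))\<^sup>2 - (d i j)\<^sup>2) * ((z $ i - z $ j) \<bullet> (v $ i - v $ j)))"
  unfolding gradient_eqI[OF squared_stress_gderiv]
  by (simp add: inner_sum_right case_prod_unfold inner_diff_right inner_axis inner_commute algebra_simps)

theorem theorem1p1:
  fixes zstar :: "'n::{finite,linorder} \<Rightarrow> real ^ 'l"
    and d :: "'n \<Rightarrow> 'n \<Rightarrow> real"
  assumes "CARD('k) \<ge> 2 * (CARD('l) + 1)"
    and "\<And>i j. i < j \<Longrightarrow> d i j = norm (zstar i - zstar j)"
  shows "benign_landscape (squared_stress d :: real ^ 'k ^ ('n::{finite,linorder}) \<Rightarrow> real)"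
  unfolding benign_landscape_def global_minimizer_def
proof (intro allI impI)
  fix z y :: "real ^ 'k ^ ('n::{finite,linorder})"
  assume soc: "second_order_critical_point (squared_stress d) z"
  \<comment> \<open>Using \<open>zstar\<close> instead of \<open>d\<close>, which is prescribed only
    for \<open>i < j\<close>, makes \<open>w\<close> symmetric with zero diagonal.\<close>
  define w where "w i j = (norm (z $ i - z $ j))\<^sup>2 - (norm (zstar i - zstar j))\<^sup>2" for i j
  have w: "w i j = w j i" "w i i = 0" for i j
    by (auto simp: w_def norm_minus_commute)
  have wd: "(norm (z $ i - z $ j))\<^sup>2 = w i j + (d i j)\<^sup>2" if "i < j" for i j
    using assms(2)[OF that] by (simp add: w_def)
  have crit: "(\<Sum>i\<in>UNIV. \<Sum>j\<in>UNIV. w i j * ((z $ i - z $ j) \<bullet> x)\<^sup>2) = 0" for x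
  proof -
    have "(\<Sum>i\<in>UNIV. \<Sum>j\<in>UNIV. w i j * ((z $ i - z $ j) \<bullet> x)\<^sup>2) =
        2 * (\<Sum>(i, j) | i < j. w i j * ((z $ i - z $ j) \<bullet> x)\<^sup>2)"
      by (rule sum_symmetric_pairs)
        (simp_all add: w(2) w(1) inner_diff_left power2_commute)
    \<comment> \<open>In this direction \<open>v i - v j\<close> is the multiple of \<open>x\<close>
      by \<open>(z $ i - z $ j) \<bullet> x\<close>, so the inner product in the gradient becomes a
      square.\<close>
    also have "\<dots> = (\<chi> i. (z $ i \<bullet> x) *\<^sub>R x) \<bullet> gradient (squared_stress d) z"
      unfolding inner_gradient_squared_stress sum_distrib_left
      by (intro sum.cong refl)
        (auto simp: wd power2_eq_square[of "_ \<bullet> x"] simp flip: scaleR_diff_left inner_diff_left)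
    also have "\<dots> = 0"
      using soc by (simp add: second_order_critical_point_def)
    finally show ?thesis .
  qed
  have hess: "0 \<le> (\<Sum>i\<in>UNIV. \<Sum>j\<in>UNIV.
      (w i j * (norm x)\<^sup>2 + 2 * ((z $ i - z $ j) \<bullet> x)\<^sup>2) * (u i - u j)\<^sup>2)" for u x
  proof -
    \<comment> \<open>Moving all points along one vector \<open>x\<close> turns both Hessian terms
      into multiples of the square of \<open>u i - u j\<close>, hence into a Laplacian form.\<close>
    let ?v = "\<chi> i. u i *\<^sub>R x"
    have "0 \<le> ?v \<bullet> hessian (squared_stress d) z ?v"
      using soc by (simp add: second_order_critical_point_def)
    also have "\<dots> = 2 * (\<Sum>(i, j) | i < j.
        (w i j * (norm x)\<^sup>2 + 2 * ((z $ i - z $ j) \<bullet> x)\<^sup>2) * (u i - u j)\<^sup>2)"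
      unfolding inner_hessian_squared_stress sum_distrib_left
      by (intro sum.cong refl)
        (auto simp: wd power_mult_distrib distrib_left distrib_right simp flip: scaleR_diff_left)
    also have "\<dots> = (\<Sum>i\<in>UNIV. \<Sum>j\<in>UNIV.
        (w i j * (norm x)\<^sup>2 + 2 * ((z $ i - z $ j) \<bullet> x)\<^sup>2) * (u i - u j)\<^sup>2)"
      by (rule sum_symmetric_pairs[symmetric])
        (simp_all add: w(1) inner_diff_left power2_commute)
    finally show ?thesis .
  qed
  \<comment> \<open>Since \<open>CARD('l)\<close> is at least 1, the assumed bound leaves room for
    the \<open>CARD('l) + 2\<close> linear conditions on \<open>x\<close>.\<close>
  have "m + 3 \<le> 2 * (m + 1)" if "0 < m" for m :: nat
    using that by simp
  from order_trans[OF this[OF zero_less_card_finite] assms(1)]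
  have dim: "DIM(real ^ 'l) + 3 \<le> DIM(real ^ 'k)"
    by simp
  have "w i j = 0" for i j
    by (rule stress_residual_zero[of w "($) z" zstar, OF w_def dim crit hess])
  then have "squared_stress d z = 0"
    unfolding squared_stress_def by (auto simp: wd intro!: sum.neutral)
  also have "0 \<le> squared_stress d y"
    unfolding squared_stress_def by (auto intro!: sum_nonneg)
  finally show "squared_stress d z \<le> squared_stress d y" .
qed

end
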